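(* Let $k\ge2$ and let $H=(V,E)$ be a directed $k$-uniform hypergraph with vertex set $V=[n]$. Let $\mathbb{F}$ be a field. Let $f\in(\mathbb{F}^n)^{\otimes k}$ be a tensor such that $f_{e_1,\dots,e_k}=0$ for every $e=(e_1,\dots,e_k)\in[n]^k$ that is not in $E$ and not of the form $(i,\dots,i)$, and such that $f_{i,\dots,i}=1$ for every $i\in[n]$. Then $\alpha(H)\le\mathrm{Q}_{\mathrm{s}}(f)$.
   Context: A directed $k$-uniform hypergraph is a pair $(V,E)$ with $V$ a finite set and $E\subseteq V^k$ a set of $k$-tuples. A subset $S\subseteq V$ is independent if $E\cap S^{k}=\emptyset$, and $\alpha(H)$ is the size of the largest independent set. For $r\ge0$ the unit tensor is $\langle r\rangle=\sum_{i=1}^r e_i^{\otimes k}\in(\mathbb{F}^r)^{\otimes k}$. The symmetric subrank $\mathrm{Q}_{\mathrm{s}}(f)$ of $f\in(\mathbb{F}^n)^{\otimes k}$ (not necessarily symmetric) is the largest $r$ such that there is a linear map $A:\mathbb{F}^n\to\mathbb{F}^r$ with $\langle r\rangle=A^{\otimes k}f$. *)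

theory Defs
  imports "Jordan_Normal_Form.Matrix" "HOL-Library.NList"
begin

text \<open>\<^bold>\<open>Conventions.\<close> The set [n] is \<open>{..<n}\<close>, and k-tuples over V are the lists in \<open>nlists k V\<close>.\<close>

definition directed_hypergraph :: "nat \<Rightarrow> 'v set \<Rightarrow> 'v list set \<Rightarrow> bool" where
  "directed_hypergraph k V E \<longleftrightarrow> finite V \<and> E \<subseteq> nlists k V"

definition independent_set :: "nat \<Rightarrow> 'v set \<Rightarrow> 'v list set \<Rightarrow> 'v set \<Rightarrow> bool" where
  "independent_set k V E S \<longleftrightarrow> S \<subseteq> V \<and> E \<inter> nlists k S = {}"

definition independence_number :: "nat \<Rightarrow> 'v set \<Rightarrow> 'v list set \<Rightarrow> nat" where
  "independence_number k V E = Max {card S | S. independent_set k V E S}"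

text \<open>
  An element of the k-th tensor power of \<open>F\<^sup>n\<close> is its coefficient function with respect to the
  standard basis. Coefficient functions vanish outside \<open>nlists k {..<n}\<close>, so that equality
  of functions is equality of tensors.
\<close>

definition tensor_space :: "nat \<Rightarrow> nat \<Rightarrow> (nat list \<Rightarrow> 'a::zero) set" where
  "tensor_space k n = {f. \<forall>e. e \<notin> nlists k {..<n} \<longrightarrow> f e = 0}"

text \<open>The coefficients of \<open>v\<^sub>1 \<otimes> \<dots> \<otimes> v\<^sub>k\<close>.\<close>

definition pure_tensor :: "'a::comm_semiring_1 vec list \<Rightarrow> nat list \<Rightarrow> 'a" where
  "pure_tensor vs e =
     (if length e = length vs \<and> (\<forall>l<length vs. e ! l < dim_vec (vs ! l))
      then \<Prod>l<length vs. vs ! l $ (e ! l) else 0)"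

definition unit_tensor :: "nat \<Rightarrow> nat \<Rightarrow> nat list \<Rightarrow> 'a::comm_semiring_1" where
  "unit_tensor k r = (\<lambda>e. \<Sum>i<r. pure_tensor (replicate k (unit_vec r i)) e)"

text \<open>
  A linear map from \<open>F\<^sup>n\<close> to \<open>F\<^sup>r\<close> is its matrix A in \<open>carrier_mat r n\<close>. Its k-th tensor
  power sends the basis tensor indexed by \<open>(d\<^sub>1,\<dots>,d\<^sub>k)\<close> to the pure tensor of the vectors
  \<open>A e\<^bsub>d\<^sub>j\<^esub>\<close>, and is extended linearly.
\<close>

definition tensor_power_map ::
    "nat \<Rightarrow> 'a::comm_semiring_1 mat \<Rightarrow> (nat list \<Rightarrow> 'a) \<Rightarrow> nat list \<Rightarrow> 'a" where
  "tensor_power_map k A f =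
     (\<lambda>e. \<Sum>d\<in>nlists k {..<dim_col A}.
        f d * pure_tensor (map (\<lambda>j. A *\<^sub>v unit_vec (dim_col A) j) d) e)"

text \<open>For \<open>k \<ge> 2\<close> the set below is finite (it is contained in \<open>{..n}\<close>), and it always contains 0
  for \<open>k \<ge> 1\<close>.\<close>

definition symmetric_subrank :: "nat \<Rightarrow> nat \<Rightarrow> (nat list \<Rightarrow> 'a::field) \<Rightarrow> nat" where
  "symmetric_subrank k n f =
     Max {r. \<exists>A \<in> carrier_mat r n. unit_tensor k r = tensor_power_map k A f}"

end

theory Submission
  imports Defs "Jordan_Normal_Form.Determinant"
begin

text \<open>
  The coordinate projection onto an independent set S restricts f to a tensor supported on the
  diagonal with ones there, that is, to the unit tensor of size |S|. The maximum defining the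
  symmetric subrank exists because a restriction of f to \<open>\<langle>r\<rangle>\<close> by A, flattened along its first
  factor, gives a right inverse of A, so that \<open>r \<le> n\<close>.
\<close>

lemma finite_nlists: "finite A \<Longrightarrow> finite (nlists k A)"
  by (induction k) (auto simp: nlists_Suc)

lemma in_nlists_iff_nth: "e \<in> nlists k A \<longleftrightarrow> length e = k \<and> (\<forall>l<k. e ! l \<in> A)"
  unfolding nlists_def by (auto simp: set_conv_nth)

(* The premises of these simp rules are themselves rewritten by in_nlists_iff_nth, which loops. *)
declare nlistsE_length [simp del] nlistsE_set [simp del]

lemma pure_tensor_columns:
  fixes A :: "'a::comm_semiring_1 mat"
  assumes "A \<in> carrier_mat r n" and d: "d \<in> nlists k {..<n}"
  shows "pure_tensor (map (\<lambda>j. A *\<^sub>v unit_vec (dim_col A) j) d) e =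
    (if e \<in> nlists k {..<r} then \<Prod>l<k. A $$ (e ! l, d ! l) else 0)"
proof -
  have d': "length d = k" "\<And>l. l < k \<Longrightarrow> d ! l < n"
    using d by (auto simp: in_nlists_iff_nth)
  then show ?thesis
    using assms(1) by (auto simp: pure_tensor_def in_nlists_iff_nth intro!: prod.cong)
qed

text \<open>Coordinate form of the tensor power; all later computations with
  \<open>tensor_power_map\<close> go through it.\<close>

lemma tensor_power_map_apply:
  fixes A :: "'a::comm_semiring_1 mat"
  assumes A: "A \<in> carrier_mat r n"
  shows "tensor_power_map k A f e =
    (if e \<in> nlists k {..<r}
     then \<Sum>d\<in>nlists k {..<n}. f d * (\<Prod>l<k. A $$ (e ! l, d ! l)) else 0)"
proof -
  have "dim_col A = n" using A by simp
  then show ?thesis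
    unfolding tensor_power_map_def using pure_tensor_columns[OF A]
    by (auto intro!: sum.cong sum.neutral)
qed

text \<open>For k > 0 the list \<open>replicate k i\<close> determines i, so at most one summand is
  nonzero. For k = 0 all r summands would equal 1 at the empty list.\<close>

lemma unit_tensor_apply:
  assumes "k > 0"
  shows "(unit_tensor k r e :: 'a::comm_semiring_1) = (if \<exists>i<r. e = replicate k i then 1 else 0)"
proof -
  have summand: "pure_tensor (replicate k (unit_vec r i)) e =
      (if e = replicate k i then 1 else (0::'a))" if "i < r" for i
  proof (cases "e = replicate k i")
    case True
    then show ?thesis using that by (simp add: pure_tensor_def)
  next
    case False
    have "(\<Prod>l<k. unit_vec r i $ (e ! l)) = (0::'a)"
      if "length e = k" "\<forall>l<k. e ! l < r"
    proof -
      obtain l where l: "l < k" "e ! l \<noteq> i"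
        using False \<open>length e = k\<close> by (auto simp: list_eq_iff_nth_eq)
      then have "unit_vec r i $ (e ! l) = (0::'a)"
        using that \<open>i < r\<close> by simp
      then show ?thesis using l(1) by (intro prod_zero) auto
    qed
    then show ?thesis using False by (auto simp: pure_tensor_def)
  qed
  have "unit_tensor k r e = (\<Sum>i<r. if e = replicate k i then 1 else (0::'a))"
    unfolding unit_tensor_def using summand by (intro sum.cong) auto
  also have "\<dots> = (if \<exists>i<r. e = replicate k i then 1 else 0)"
  proof (cases "\<exists>i<r. e = replicate k i")
    case True
    then obtain i where "i < r" "e = replicate k i" by blast
    then show ?thesis using assms by auto
  qed auto
  finally show ?thesis .
qed

lemma right_inverse_dim_le:
  fixes A :: "'a::field mat"
  assumes "A \<in> carrier_mat r n" "B \<in> carrier_mat n r" "A * B = 1\<^sub>m r"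
  shows "r \<le> n"
proof (rule ccontr)
  assume "\<not> r \<le> n"
  then have n: "n < r" by simp
  text \<open>Padding A and B by zeros to square matrices turns the one-sided inverse into a two-sided one.\<close>
  define A' where "A' = mat r r (\<lambda>(i, j). if j < n then A $$ (i, j) else 0)"
  define B' where "B' = mat r r (\<lambda>(i, j). if i < n then B $$ (i, j) else 0)"
  have carrier: "A' \<in> carrier_mat r r" "B' \<in> carrier_mat r r"
    by (auto simp: A'_def B'_def)
  have "A' * B' = A * B"
  proof (rule eq_matI)
    fix i j assume "i < dim_row (A * B)" "j < dim_col (A * B)"
    then have ij: "i < r" "j < r" using assms by auto
    have "(A' * B') $$ (i, j) = (\<Sum>l<r. A' $$ (i, l) * B' $$ (l, j))"
      using ij carrier by (auto simp: scalar_prod_def atLeast0LessThan)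
    also have "\<dots> = (\<Sum>l<n. A $$ (i, l) * B $$ (l, j))"
      using ij n by (intro sum.mono_neutral_cong_right) (auto simp: A'_def B'_def)
    also have "\<dots> = (A * B) $$ (i, j)"
      using ij assms(1,2) by (auto simp: scalar_prod_def atLeast0LessThan)
    finally show "(A' * B') $$ (i, j) = (A * B) $$ (i, j)" .
  qed (use assms carrier in auto)
  then have "B' * A' = 1\<^sub>m r"
    using mat_mult_left_right_inverse[OF carrier] assms by simp
  \<comment> \<open>The index n is the first padded one: row n of \<open>B'\<close> and column n of
    \<open>A'\<close> are zero, while n < r keeps (n, n) inside the matrix.\<close>
  moreover have "(B' * A') $$ (n, n) = 0"
    using n carrier by (auto simp: scalar_prod_def A'_def B'_def intro!: sum.neutral)
  ultimately show False using n by simp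
qed

text \<open>At the index (i, j, ..., j) the unit tensor has the entry of the identity matrix at (i,
  j), whereas the image of f depends linearly on row i of \<open>A\<close> through the first factor.
  This reads as a matrix product with \<open>A\<close> on the left.\<close>

lemma restriction_dim_le:
  fixes A :: "'a::field mat"
  assumes k: "k \<ge> 2" and A: "A \<in> carrier_mat r n"
    and eq: "unit_tensor k r = tensor_power_map k A f"
  shows "r \<le> n"
proof -
  obtain m where m: "k = Suc m" "m > 0" using k by (cases k) auto
  let ?D = "nlists k {..<n}"
  \<comment> \<open>Column j of \<open>B\<close> is f contracted with row j of \<open>A\<close> in
    every factor except the first, whose index c stays free.\<close>
  define B where "B = mat n r (\<lambda>(c, j).
    \<Sum>d\<in>{d\<in>?D. d ! 0 = c}. f d * (\<Prod>l<m. A $$ (j, d ! Suc l)))"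
  have B: "B \<in> carrier_mat n r" by (simp add: B_def)
  have "A * B = 1\<^sub>m r"
  proof (rule eq_matI)
    fix i j assume "i < dim_row (1\<^sub>m r :: 'a mat)" "j < dim_col (1\<^sub>m r :: 'a mat)"
    then have ij: "i < r" "j < r" by auto
    define e where "e = i # replicate m j"
    have e: "e \<in> nlists k {..<r}"
      using ij by (simp add: e_def m(1) nlists_replicateI)
    have "(A * B) $$ (i, j) = (\<Sum>c<n. A $$ (i, c) * B $$ (c, j))"
      using ij A B by (auto simp: scalar_prod_def atLeast0LessThan)
    also have "\<dots> = (\<Sum>c<n. \<Sum>d\<in>{d\<in>?D. d ! 0 = c}.
        f d * (A $$ (i, d ! 0) * (\<Prod>l<m. A $$ (j, d ! Suc l))))"
    proof (rule sum.cong)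
      fix c assume "c \<in> {..<n}"
      then have "B $$ (c, j) = (\<Sum>d\<in>{d\<in>?D. d ! 0 = c}. f d * (\<Prod>l<m. A $$ (j, d ! Suc l)))"
        using ij by (simp add: B_def)
      then show "A $$ (i, c) * B $$ (c, j) = (\<Sum>d\<in>{d\<in>?D. d ! 0 = c}.
          f d * (A $$ (i, d ! 0) * (\<Prod>l<m. A $$ (j, d ! Suc l))))"
        by (auto simp: sum_distrib_left mult_ac intro!: sum.cong)
    qed simp
    \<comment> \<open>The fibres of the first coordinate partition the index set, so the double sum
      collapses.\<close>
    also have "\<dots> = (\<Sum>d\<in>?D. f d * (A $$ (i, d ! 0) * (\<Prod>l<m. A $$ (j, d ! Suc l))))"
    proof (rule sum.group)
      show "finite ?D" by (simp add: finite_nlists)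
      show "(\<lambda>d. d ! 0) ` ?D \<subseteq> {..<n}"
        using m by (auto simp: in_nlists_iff_nth)
    qed simp
    also have "\<dots> = tensor_power_map k A f e"
      using e by (simp add: tensor_power_map_apply[OF A] m(1) e_def prod.lessThan_Suc_shift
          del: prod.lessThan_Suc)
    also have "\<dots> = (if \<exists>i<r. e = replicate k i then 1 else 0)"
      unfolding eq[symmetric] using m by (simp add: unit_tensor_apply)
    \<comment> \<open>Since m > 0, the index j does occur in \<open>e\<close>, so \<open>e\<close>
      is constant exactly when i = j.\<close>
    also have "\<dots> = 1\<^sub>m r $$ (i, j)"
      using ij m by (auto simp: e_def)
    finally show "(A * B) $$ (i, j) = 1\<^sub>m r $$ (i, j)" .
  qed (use A B in auto)
  then show ?thesis using right_inverse_dim_le A B by blast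
qed

text \<open>Row i of the matrix is the unit vector at \<open>g i\<close>, so a single mismatch
  between d and \<open>map g e\<close> kills the product, and only d = \<open>map g e\<close>
  survives in the sum.\<close>

lemma tensor_power_map_projection:
  fixes f :: "nat list \<Rightarrow> 'a::comm_semiring_1"
  assumes "\<And>i. i < r \<Longrightarrow> g i < n" and e: "e \<in> nlists k {..<r}"
  shows "tensor_power_map k (mat r n (\<lambda>(i, j). if j = g i then 1 else 0)) f e = f (map g e)"
proof -
  let ?A = "mat r n (\<lambda>(i, j). if j = g i then 1 else 0) :: 'a mat"
  let ?D = "nlists k {..<n}"
  have len: "length e = k" and e_lt: "\<And>l. l < k \<Longrightarrow> e ! l < r"
    using e by (auto simp: in_nlists_iff_nth)
  have ge: "map g e \<in> ?D" using assms by (simp add: in_nlists_iff_nth)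
  have fin: "finite ?D" by (simp add: finite_nlists)
  have summand: "f d * (\<Prod>l<k. ?A $$ (e ! l, d ! l)) = (if d = map g e then f d else 0)"
    if d: "d \<in> ?D" for d
  proof -
    have ld: "length d = k" and d_lt: "\<And>l. l < k \<Longrightarrow> d ! l < n"
      using d by (auto simp: in_nlists_iff_nth)
    have "(\<Prod>l<k. ?A $$ (e ! l, d ! l)) = (\<Prod>l<k. if d ! l = g (e ! l) then 1 else 0)"
      using e_lt d_lt by (intro prod.cong) auto
    also have "\<dots> = (if d = map g e then 1 else 0)"
    proof (cases "d = map g e")
      case True
      then show ?thesis using len by auto
    next
      case False
      then obtain l where "l < k" "d ! l \<noteq> g (e ! l)"
        using len ld by (auto simp: list_eq_iff_nth_eq)
      then show ?thesis using False by (auto intro!: prod_zero bexI[of _ l])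
    qed
    finally show ?thesis by simp
  qed
  have "tensor_power_map k ?A f e = (\<Sum>d\<in>?D. if d = map g e then f d else 0)"
    using e summand by (subst tensor_power_map_apply[of _ r n]) (auto intro!: sum.cong)
  then show ?thesis using ge fin by simp
qed

lemma independent_set_restriction:
  fixes f :: "nat list \<Rightarrow> 'a::comm_semiring_1"
  assumes k: "k > 0" and S: "independent_set k {..<n} E S"
    and off: "\<And>e. e \<in> nlists k {..<n} \<Longrightarrow> e \<notin> E \<Longrightarrow> \<not> (\<exists>i. e = replicate k i) \<Longrightarrow> f e = 0"
    and diag: "\<And>i. i < n \<Longrightarrow> f (replicate k i) = 1"
  shows "\<exists>A \<in> carrier_mat (card S) n. unit_tensor k (card S) = tensor_power_map k A f"
proof -
  let ?r = "card S"
  have Sn: "S \<subseteq> {..<n}" and SE: "E \<inter> nlists k S = {}"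
    using S by (auto simp: independent_set_def)
  \<comment> \<open>An enumeration of S; the projection onto the coordinates in S is the matrix
    built from it.\<close>
  obtain g where g: "bij_betw g {..<?r} S"
    using Sn ex_bij_betw_nat_finite[of S] by (auto simp: atLeast0LessThan intro: finite_subset)
  have gS: "g i \<in> S" if "i < ?r" for i using g that by (auto simp: bij_betw_def)
  have gn: "g i < n" if "i < ?r" for i using gS[OF that] Sn by auto
  let ?A = "mat ?r n (\<lambda>(i, j). if j = g i then 1 else 0) :: 'a mat"
  have A: "?A \<in> carrier_mat ?r n" by simp
  have "unit_tensor k ?r e = tensor_power_map k ?A f e" for e
  proof (cases "e \<in> nlists k {..<?r}")
    case False
    then have "\<not> (\<exists>i<?r. e = replicate k i)" by (auto simp: in_nlists_iff_nth)
    then show ?thesis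
      using False k by (simp add: tensor_power_map_apply[OF A] unit_tensor_apply)
  next
    case True
    have map: "tensor_power_map k ?A f e = f (map g e)"
      using True gn by (rule tensor_power_map_projection[rotated])
    show ?thesis
    proof (cases "\<exists>i<?r. e = replicate k i")
      case const: True
      then show ?thesis using k diag gn by (auto simp: map unit_tensor_apply)
    next
      case nonconst: False
      have len: "length e = k" and e_lt: "\<And>l. l < k \<Longrightarrow> e ! l < ?r"
        using True by (auto simp: in_nlists_iff_nth)
      \<comment> \<open>Injectivity of g reflects constancy, so a nonconstant index is sent off the
        diagonal.\<close>
      have "map g e \<noteq> replicate k i" for i
      proof
        assume const: "map g e = replicate k i"
        have "g (e ! l) = g (e ! 0)" if "l < k" for l
          using const that len k by (metis nth_map nth_replicate)
        moreover have "inj_on g {..<?r}" using g by (rule bij_betw_imp_inj_on)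
        ultimately have "e ! l = e ! 0" if "l < k" for l
          using that e_lt[OF that] e_lt[OF k] by (metis inj_on_eq_iff lessThan_iff)
        then have "e = replicate k (e ! 0)"
          using len by (metis length_replicate nth_equalityI nth_replicate)
        then show False using nonconst e_lt k by blast
      qed
      moreover have "map g e \<in> nlists k S" "map g e \<in> nlists k {..<n}"
        using True gS gn by (auto simp: in_nlists_iff_nth)
      \<comment> \<open>A tuple over the independent set S is no edge, so f vanishes there off the
        diagonal.\<close>
      ultimately have "f (map g e) = 0" using SE by (intro off) auto
      then show ?thesis using nonconst k by (simp add: map unit_tensor_apply)
    qed
  qed
  then show ?thesis using A by blast
qed

theorem proposition2p3:
  fixes k n :: nat and E :: "nat list set" and f :: "nat list \<Rightarrow> 'a::field"
  assumes "k \<ge> 2"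
    and "directed_hypergraph k {..<n} E"
    and "f \<in> tensor_space k n"
    and "\<And>e. e \<in> nlists k {..<n} \<Longrightarrow> e \<notin> E \<Longrightarrow> \<not> (\<exists>i. e = replicate k i) \<Longrightarrow> f e = 0"
    and "\<And>i. i < n \<Longrightarrow> f (replicate k i) = 1"
  shows "independence_number k {..<n} E \<le> symmetric_subrank k n f"
proof -
  let ?I = "{card S | S. independent_set k {..<n} E S}"
  let ?R = "{r. \<exists>A \<in> carrier_mat r n. unit_tensor k r = tensor_power_map k A f}"
  \<comment> \<open>\<open>Max\<close> is monotone under inclusion once the larger set is finite and
    the smaller one is nonempty.\<close>
  have "finite ?R"
    using restriction_dim_le[OF assms(1)] by (intro finite_subset[of ?R "{..n}"]) auto
  moreover have "?I \<subseteq> ?R"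
    using independent_set_restriction[of k n E _ f] assms by auto
  \<comment> \<open>As k > 0, there are no k-tuples over the empty set.\<close>
  moreover have "independent_set k {..<n} E {}"
    using assms(1) by (auto simp: independent_set_def nlists_def)
  then have "?I \<noteq> {}" by blast
  ultimately show ?thesis
    unfolding independence_number_def symmetric_subrank_def by (intro Max_mono)
qed

end
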